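(* Let $\Sigma$ be a compact connected oriented surface of genus $g\geq 1$, let $H=H_1(\Sigma,\mathbb{Z})$ with intersection form $\langle -,-\rangle$, and let $\mathbb{Q}H$ be the homological Goldman Lie algebra of $\Sigma$. Suppose the intersection form $\langle -,-\rangle$ is non-degenerate. Then there is a subset $S$ of $H$ such that $\{[s]\mid s\in S\}$ generates $\mathbb{Q}H$ as a Lie algebra and $\#S=2g+2$. In particular, the Lie algebra $\mathbb{Q}H$ is finitely generated. Moreover, if $S$ is any subset of $H$ such that $\{[s]\mid s\in S\}$ generates $\mathbb{Q}H$ as a Lie algebra, then $\#S\geq 2g+2$.
   Context: The intersection form is the skew-symmetric bilinear form $\langle -,-\rangle: H\times H\to\mathbb{Z}$ on $H=H_1(\Sigma,\mathbb{Z})$. It is non-degenerate exactly when $\Sigma$ is closed or has one boundary component; in that case $H$ is a free $\mathbb{Z}$-module of rank $2g$ admitting a symplectic basis, i.e. a $\mathbb{Z}$-basis $\{A_i,B_i\}_{i=1}^g$ with $\langle A_i,B_j\rangle=\delta_{ij}$ and $\langle A_i,A_j\rangle=\langle B_i,B_j\rangle=0$ for all $i,j$. $\mathbb{Q}H$ denotes the $\mathbb{Q}$-vector space with basis the set $H$; the basis element corresponding to $x\in H$ is written $[x]$ (so $[0]$ is a nonzero basis vector). The homological Goldman Lie algebra of $\Sigma$ is $\mathbb{Q}H$ equipped with the Lie bracket that is the bilinear extension of $[[x],[y]]:=\langle x,y\rangle[x+y]$ for $x,y\in H$. A subset generates a Lie algebra if the smallest Lie subalgebra (over $\mathbb{Q}$)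 containing it is the whole Lie algebra. $\#S$ denotes cardinality. *)

theory Defs
  imports
    "HOL-Homology.Homology"
    "HOL-Complex_Analysis.Complex_Analysis"
begin

section \<open>Compact connected oriented surfaces\<close>

text \<open>Surfaces are topological 2-manifolds, possibly with boundary. Second countability is
  automatic for a compact locally Euclidean space.\<close>

definition compact_connected_surface :: "'a topology \<Rightarrow> bool" where
  "compact_connected_surface X \<longleftrightarrow>
     topspace X \<noteq> {} \<and> compact_space X \<and> connected_space X \<and> Hausdorff_space X \<and>
     (\<forall>x \<in> topspace X. \<exists>U V. openin X U \<and> x \<in> U \<and>
        openin (top_of_set {z::complex. 0 \<le> Im z}) V \<and>
        subtopology X U homeomorphic_space top_of_set V)"

definition chart :: "'a topology \<Rightarrow> 'a set \<Rightarrow> ('a \<Rightarrow> complex) \<Rightarrow> bool" where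
  "chart X U \<phi> \<longleftrightarrow> openin X U \<and> open (\<phi> ` U) \<and>
     homeomorphic_map (subtopology X U) (top_of_set (\<phi> ` U)) \<phi>"

text \<open>Charts have images open in the whole plane, so by invariance of domain they cover exactly
  the points that are not on the boundary.\<close>

definition surface_interior :: "'a topology \<Rightarrow> 'a set" where
  "surface_interior X = \<Union> {U. \<exists>\<phi>. chart X U \<phi>}"

definition surface_boundary :: "'a topology \<Rightarrow> 'a set" where
  "surface_boundary X = topspace X - surface_interior X"

text \<open>A local homeomorphism of the plane preserves orientation at a point if it maps small
  positively oriented circles around that point to curves winding once around the image point.\<close>

definition orientation_preserving_at :: "(complex \<Rightarrow> complex) \<Rightarrow> complex \<Rightarrow> bool" where
  "orientation_preserving_at f z \<longleftrightarrow>
     (\<forall>\<^sub>F r in at_right 0. winding_number (f \<circ> circlepath z r) (f z) = 1)"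

definition compatible_charts ::
    "'a set \<Rightarrow> ('a \<Rightarrow> complex) \<Rightarrow> 'a set \<Rightarrow> ('a \<Rightarrow> complex) \<Rightarrow> bool" where
  "compatible_charts U \<phi> V \<psi> \<longleftrightarrow>
     (\<forall>x \<in> U \<inter> V. orientation_preserving_at (\<psi> \<circ> inv_into U \<phi>) (\<phi> x))"

text \<open>An orientation is a maximal oriented atlas of the interior.\<close>

definition surface_orientation :: "'a topology \<Rightarrow> ('a set \<times> ('a \<Rightarrow> complex)) set \<Rightarrow> bool" where
  "surface_orientation X \<A> \<longleftrightarrow>
     (\<Union>(U, \<phi>) \<in> \<A>. U) = surface_interior X \<and>
     \<A> = {(U, \<phi>). chart X U \<phi> \<and> (\<forall>(V, \<psi>) \<in> \<A>. compatible_charts U \<phi> V \<psi>)}"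

section \<open>Loops and the intersection form\<close>

text \<open>Loops are 1-periodic maps on the real line.\<close>

definition loop :: "'a topology \<Rightarrow> (real \<Rightarrow> 'a) \<Rightarrow> bool" where
  "loop X p \<longleftrightarrow> continuous_map euclideanreal X p \<and> (\<forall>t. p (t + 1) = p t)"

definition simple_loop :: "'a topology \<Rightarrow> (real \<Rightarrow> 'a) \<Rightarrow> bool" where
  "simple_loop X p \<longleftrightarrow> loop X p \<and> inj_on p {0..<1}"

text \<open>The class in \<open>H\<^sub>1\<close> of the singular 1-simplex obtained by running once through the loop;
  \<open>x 1\<close> is the second barycentric coordinate.\<close>

definition loop_class :: "'a topology \<Rightarrow> (real \<Rightarrow> 'a) \<Rightarrow> 'a chain set" where
  "loop_class X p =
     homologous_rel_set 1 X {} (frag_of (restrict (\<lambda>x. p (x 1)) (standard_simplex 1)))"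

definition crossings :: "(real \<Rightarrow> 'a) \<Rightarrow> (real \<Rightarrow> 'a) \<Rightarrow> (real \<times> real) set" where
  "crossings p q = {(s, t). s \<in> {0..<1} \<and> t \<in> {0..<1} \<and> p s = q t}"

text \<open>For \<open>\<epsilon> = 1\<close> (or \<open>-1\<close>): in some oriented chart, near the crossing, \<open>p\<close> runs along the
  real axis to the right while \<open>q\<close> runs along the imaginary axis upwards (or downwards).\<close>

definition crosses_with_sign ::
    "('a set \<times> ('a \<Rightarrow> complex)) set \<Rightarrow> (real \<Rightarrow> 'a) \<Rightarrow> (real \<Rightarrow> 'a) \<Rightarrow> int \<Rightarrow> real \<times> real \<Rightarrow> bool" where
  "crosses_with_sign \<A> p q \<epsilon> = (\<lambda>(s, t).
     \<exists>(U, \<phi>) \<in> \<A>. \<exists>\<delta>>0. \<forall>u. \<bar>u\<bar> < \<delta> \<longrightarrow>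
       p (s + u) \<in> U \<and> q (t + u) \<in> U \<and>
       \<phi> (p (s + u)) = of_real u \<and> \<phi> (q (t + u)) = of_int \<epsilon> * of_real u * \<i>)"

definition transverse ::
    "('a set \<times> ('a \<Rightarrow> complex)) set \<Rightarrow> (real \<Rightarrow> 'a) \<Rightarrow> (real \<Rightarrow> 'a) \<Rightarrow> bool" where
  "transverse \<A> p q \<longleftrightarrow> finite (crossings p q) \<and>
     (\<forall>c \<in> crossings p q. crosses_with_sign \<A> p q 1 c \<or> crosses_with_sign \<A> p q (-1) c)"

definition intersection_number ::
    "('a set \<times> ('a \<Rightarrow> complex)) set \<Rightarrow> (real \<Rightarrow> 'a) \<Rightarrow> (real \<Rightarrow> 'a) \<Rightarrow> int" where
  "intersection_number \<A> p q =
     (\<Sum>c \<in> crossings p q. if crosses_with_sign \<A> p q 1 c then 1 else -1)"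

text \<open>The group operation of \<^const>\<open>relative_homology_group\<close> is written multiplicatively.\<close>

definition skew_bilinear :: "('h, 'b) monoid_scheme \<Rightarrow> ('h \<Rightarrow> 'h \<Rightarrow> int) \<Rightarrow> bool" where
  "skew_bilinear G \<omega> \<longleftrightarrow>
     (\<forall>x \<in> carrier G. \<forall>y \<in> carrier G. \<forall>z \<in> carrier G.
        \<omega> (x \<otimes>\<^bsub>G\<^esub> y) z = \<omega> x z + \<omega> y z \<and> \<omega> z (x \<otimes>\<^bsub>G\<^esub> y) = \<omega> z x + \<omega> z y) \<and>
     (\<forall>x \<in> carrier G. \<forall>y \<in> carrier G. \<omega> x y = - \<omega> y x)"

definition nondegenerate :: "('h, 'b) monoid_scheme \<Rightarrow> ('h \<Rightarrow> 'h \<Rightarrow> int) \<Rightarrow> bool" where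
  "nondegenerate G \<omega> \<longleftrightarrow>
     (\<forall>x \<in> carrier G. (\<forall>y \<in> carrier G. \<omega> x y = 0) \<longrightarrow> x = \<one>\<^bsub>G\<^esub>)"

text \<open>The intersection form counts, with signs, the crossings of transverse representatives.
  As the first homology of a surface is generated by loops that are pairwise transverse, this
  determines the values of \<open>\<omega>\<close> on the first homology group; its values elsewhere are irrelevant.\<close>

definition intersection_form ::
    "'a topology \<Rightarrow> ('a set \<times> ('a \<Rightarrow> complex)) set \<Rightarrow> ('a chain set \<Rightarrow> 'a chain set \<Rightarrow> int) \<Rightarrow> bool" where
  "intersection_form X \<A> \<omega> \<longleftrightarrow>
     skew_bilinear (homology_group 1 X) \<omega> \<and>
     (\<forall>p q. loop X p \<and> loop X q \<and> transverse \<A> p q \<longrightarrow>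
        \<omega> (loop_class X p) (loop_class X q) = intersection_number \<A> p q)"

section \<open>Genus\<close>

definition Z_basis :: "('h, 'b) monoid_scheme \<Rightarrow> 'i set \<Rightarrow> ('i \<Rightarrow> 'h) \<Rightarrow> bool" where
  "Z_basis G I e \<longleftrightarrow> finite I \<and> e ` I \<subseteq> carrier G \<and>
     (\<forall>x \<in> carrier G. \<exists>!n::'i \<Rightarrow> int. n \<in> extensional I \<and>
        x = (\<Otimes>\<^bsub>G\<^esub>i\<in>I. e i [^]\<^bsub>G\<^esub> n i))"

text \<open>The genus of a compact connected oriented surface is the number \<open>g\<close> of handles. It is
  expressed by a canonical system of curves: simple closed curves \<open>a\<^sub>i\<close>, \<open>b\<^sub>i\<close> in the interior,
  one pair per handle, where \<open>a\<^sub>i\<close> meets \<open>b\<^sub>i\<close> in one point, positively, and no two others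
  meet; together with \<open>r\<close> boundary curves \<open>c\<^sub>j\<close> (all boundary circles but one, or none if the
  surface is closed), they represent a basis of the first homology group. By the classification
  of surfaces such a system exists for exactly one value of \<open>g\<close>. The intersection form may be
  degenerate here: its radical is spanned by the \<open>r\<close> boundary classes.\<close>

definition has_genus :: "'a topology \<Rightarrow> ('a set \<times> ('a \<Rightarrow> complex)) set \<Rightarrow> nat \<Rightarrow> bool" where
  "has_genus X \<A> g \<longleftrightarrow> (\<exists>(r::nat) a b c.
     (\<forall>i<g. simple_loop X (a i) \<and> range (a i) \<subseteq> surface_interior X) \<and>
     (\<forall>i<g. simple_loop X (b i) \<and> range (b i) \<subseteq> surface_interior X) \<and>
     (\<forall>j<r. simple_loop X (c j) \<and> range (c j) \<subseteq> surface_boundary X) \<and>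
     (\<forall>i<g. \<exists>x. crossings (a i) (b i) = {x} \<and> crosses_with_sign \<A> (a i) (b i) 1 x) \<and>
     (\<forall>i<g. \<forall>j<g. i \<noteq> j \<longrightarrow>
        range (a i) \<inter> range (a j) = {} \<and> range (b i) \<inter> range (b j) = {} \<and>
        range (a i) \<inter> range (b j) = {}) \<and>
     (\<forall>i<r. \<forall>j<r. i \<noteq> j \<longrightarrow> range (c i) \<inter> range (c j) = {}) \<and>
     Z_basis (homology_group 1 X) ({..<g} <+> {..<g} <+> {..<r})
       (case_sum (loop_class X \<circ> a) (case_sum (loop_class X \<circ> b) (loop_class X \<circ> c))))"

section \<open>The homological Goldman Lie algebra\<close>

text \<open>The rational vector space with basis \<open>carrier G\<close>: the finitely supported functions on
  it. The basis element \<open>[x]\<close> is \<open>Poly_Mapping.single x 1\<close>, and the scalar multiple of \<open>u\<close> by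
  \<open>q\<close> is \<open>Poly_Mapping.map ((*) q) u\<close>.\<close>

definition goldman_space :: "('h, 'b) monoid_scheme \<Rightarrow> ('h \<Rightarrow>\<^sub>0 rat) set" where
  "goldman_space G = {u. Poly_Mapping.keys u \<subseteq> carrier G}"

definition basis_elt :: "'h \<Rightarrow> ('h \<Rightarrow>\<^sub>0 rat)" where
  "basis_elt x = Poly_Mapping.single x 1"

definition goldman_bracket ::
    "('h, 'b) monoid_scheme \<Rightarrow> ('h \<Rightarrow> 'h \<Rightarrow> int) \<Rightarrow> ('h \<Rightarrow>\<^sub>0 rat) \<Rightarrow> ('h \<Rightarrow>\<^sub>0 rat) \<Rightarrow> ('h \<Rightarrow>\<^sub>0 rat)" where
  "goldman_bracket G \<omega> u v =
     (\<Sum>x \<in> Poly_Mapping.keys u. \<Sum>y \<in> Poly_Mapping.keys v.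
        Poly_Mapping.single (x \<otimes>\<^bsub>G\<^esub> y)
          (Poly_Mapping.lookup u x * Poly_Mapping.lookup v y * of_int (\<omega> x y)))"

lemma goldman_bracket_basis:
  "goldman_bracket G \<omega> (basis_elt x) (basis_elt y) =
     Poly_Mapping.map ((*) (of_int (\<omega> x y))) (basis_elt (x \<otimes>\<^bsub>G\<^esub> y))"
  by (intro poly_mapping_eqI)
    (simp add: goldman_bracket_def basis_elt_def Poly_Mapping.map.rep_eq lookup_single when_def)

definition lie_subalgebra ::
    "('h, 'b) monoid_scheme \<Rightarrow> ('h \<Rightarrow> 'h \<Rightarrow> int) \<Rightarrow> ('h \<Rightarrow>\<^sub>0 rat) set \<Rightarrow> bool" where
  "lie_subalgebra G \<omega> L \<longleftrightarrow> L \<subseteq> goldman_space G \<and> 0 \<in> L \<and>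
     (\<forall>u \<in> L. \<forall>v \<in> L. u + v \<in> L) \<and>
     (\<forall>q. \<forall>u \<in> L. Poly_Mapping.map ((*) q) u \<in> L) \<and>
     (\<forall>u \<in> L. \<forall>v \<in> L. goldman_bracket G \<omega> u v \<in> L)"

definition generates_goldman ::
    "('h, 'b) monoid_scheme \<Rightarrow> ('h \<Rightarrow> 'h \<Rightarrow> int) \<Rightarrow> ('h \<Rightarrow>\<^sub>0 rat) set \<Rightarrow> bool" where
  "generates_goldman G \<omega> T \<longleftrightarrow> T \<subseteq> goldman_space G \<and>
     \<Inter> {L. lie_subalgebra G \<omega> L \<and> T \<subseteq> L} = goldman_space G"

end

theory Submission
  imports Defs "HOL-Library.Function_Algebras"
begin

text \<open>A set \<open>{[s] | s \<in> S}\<close> generates the homological Goldman Lie algebra iff every \<open>M \<supseteq> S\<close> that is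
  closed under sums of non-orthogonal elements is all of \<open>H\<close>. The nonzero elements form such a set
  \<open>M\<close>, hence \<open>0 \<in> S\<close>, and \<open>S - {0}\<close> generates \<open>H\<close> as a monoid; a free abelian group of rank \<open>2g\<close>
  needs at least \<open>2g + 1\<close> monoid generators. Conversely, take \<open>0\<close> and \<open>2g + 1\<close> vectors with sum \<open>0\<close>
  that span \<open>H\<close> and whose intersection graph is a cycle. Adding up three consecutive ones
  gives the same configuration in genus \<open>g - 1\<close>, so one can proceed by induction on the genus.
  The surface enters only through its symplectic basis: boundary curves would lie in the radical
  of the form.\<close>

section \<open>Sets closed under the addition of non-orthogonal vectors\<close>

text \<open>Starting from \<open>(c, d)\<close>, add \<open>(a, b)\<close> \<open>k\<close> times
  and then \<open>(c, d)\<close> another \<open>l - 1\<close> times. Each step pairs the current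
  vector with the added one to a nonzero multiple of the determinant; in the second phase this uses
  \<open>k > 0\<close>.\<close>

lemma plane_cone_subset:
  fixes R :: "(int \<times> int) set"
  assumes cl: "\<And>a b c d. (a, b) \<in> R \<Longrightarrow> (c, d) \<in> R \<Longrightarrow> a * d - b * c \<noteq> 0 \<Longrightarrow> (a + c, b + d) \<in> R"
    and p: "(a, b) \<in> R" and q: "(c, d) \<in> R" and det: "a * d - b * c \<noteq> 0"
    and k: "k > 0" and l: "l > 0"
  shows "(k * a + l * c, k * b + l * d) \<in> R"
proof -
  have k_step: "(int n * a + c, int n * b + d) \<in> R" for n
  proof (induction n)
    case 0
    then show ?case using q by simp
  next
    case (Suc n)
    have "(int n * a + c) * b - (int n * b + d) * a = - (a * d - b * c)"
      by (simp add: algebra_simps)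
    then show ?case
      using cl[OF Suc p] det by (simp add: algebra_simps)
  qed
  have l_step: "(int n * a + int (Suc m) * c, int n * b + int (Suc m) * d) \<in> R" if n: "n > 0" for n m
  proof (induction m)
    case 0
    then show ?case using k_step[of n] by simp
  next
    case (Suc m)
    have "(int n * a + int (Suc m) * c) * d - (int n * b + int (Suc m) * d) * c = int n * (a * d - b * c)"
      by (simp add: algebra_simps)
    then have "(int n * a + int (Suc m) * c) * d - (int n * b + int (Suc m) * d) * c \<noteq> 0"
      using det n by simp
    then show ?case
      using cl[OF Suc q] by (simp add: algebra_simps)
  qed
  have "k = int (nat k)" "l = int (Suc (nat l - 1))" "nat k > 0"
    using k l by auto
  then show ?thesis
    using l_step[of "nat k" "nat l - 1"] by simp
qed

text \<open>Any two of the three generators form a Z-basis and all three sum to zero, so each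
  lattice point off the three rays is a positive combination of two of them. The origin stays out of
  reach, since independent vectors have a nonzero sum.\<close>

lemma plane_generated:
  fixes R :: "(int \<times> int) set"
  assumes cl: "\<And>a b c d. (a, b) \<in> R \<Longrightarrow> (c, d) \<in> R \<Longrightarrow> a * d - b * c \<noteq> 0 \<Longrightarrow> (a + c, b + d) \<in> R"
    and A: "(1, 0) \<in> R" and B: "(0, 1) \<in> R" and C: "(-1, -1) \<in> R"
    and nz: "(k, l) \<noteq> (0, 0)"
  shows "(k, l) \<in> R"
proof -
  have AB: "(k, l) \<in> R" if "k > 0" "l > 0" for k l
    using plane_cone_subset[OF cl A B, of k l] that by simp
  have BC: "(k, l) \<in> R" if "k < 0" "l > k" for k l
    using plane_cone_subset[OF cl B C, of "l - k" "- k"] that by simp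
  have CA: "(k, l) \<in> R" if "l < 0" "k > l" for k l
    using plane_cone_subset[OF cl C A, of "- l" "k - l"] that by simp
  \<comment> \<open>The three open cones leave the rays through the generators, whose points are sums of
    points of two different cones.\<close>
  consider "k > 0" "l > 0" | "k < 0" "l > k" | "l < 0" "k > l"
    | "k > 0" "l = 0" | "k = 0" "l > 0" | "k < 0" "l = k"
    using nz by fastforce
  then show ?thesis
  proof cases
    case 4
    then show ?thesis
      using cl[OF AB[of "k + 2" 1] BC[of "-2" "-1"]] by simp
  next
    case 5
    then show ?thesis
      using cl[OF AB[of 1 "l + 2"] CA[of "-2" "-1"]] by simp
  next
    case 6
    then show ?thesis
      using cl[OF CA[of "k - 2" "k - 1"] AB[of 1 2]] by simp
  qed (use AB BC CA in auto)
qed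

section \<open>Skew forms on abelian groups\<close>

locale skew_form =
  fixes w :: "'v::ab_group_add \<Rightarrow> 'v \<Rightarrow> int"
  assumes add_left: "w (x + y) z = w x z + w y z"
    and skew: "w x y = - w y x"
begin

lemma add_right: "w z (x + y) = w z x + w z y"
  using add_left[of x y z] skew[of z "x + y"] skew[of x z] skew[of y z] by simp

lemma zero_left [simp]: "w 0 y = 0"
  using add_left[of 0 0 y] by simp

lemma minus_left [simp]: "w (- x) y = - w x y"
  using add_left[of x "- x" y] by simp

lemma minus_right [simp]: "w y (- x) = - w y x"
  using minus_left[of x y] skew[of y x] skew[of y "- x"] by simp

lemma diff_left: "w (x - y) z = w x z - w y z"
  using add_left[of x "- y" z] by simp

lemma diff_right: "w z (x - y) = w z x - w z y"
  using add_right[of z x "- y"] by simp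

lemma self [simp]: "w x x = 0"
  using skew[of x x] by simp

lemmas form_simps = add_left add_right diff_left diff_right

text \<open>This is what a Lie subalgebra leaves on basis elements: if \<open>w x y\<close> is
  nonzero, \<open>[x + y]\<close> is a rational multiple of the bracket of \<open>[x]\<close> and
  \<open>[y]\<close>.\<close>

definition form_closed :: "'v set \<Rightarrow> bool" where
  "form_closed R \<longleftrightarrow> (\<forall>x\<in>R. \<forall>y\<in>R. w x y \<noteq> 0 \<longrightarrow> x + y \<in> R)"

lemma form_closedD: "form_closed R \<Longrightarrow> x \<in> R \<Longrightarrow> y \<in> R \<Longrightarrow> w x y \<noteq> 0 \<Longrightarrow> x + y \<in> R"
  by (simp add: form_closed_def)

text \<open>The witness \<open>y\<close> is sought in \<open>K\<close> itself, so it is the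
  restriction of the form to \<open>K\<close> that is nondegenerate.\<close>

definition nondegenerate_subgroup :: "'v set \<Rightarrow> bool" where
  "nondegenerate_subgroup K \<longleftrightarrow> (\<forall>x\<in>K. \<forall>y\<in>K. x - y \<in> K) \<and> (\<forall>x\<in>K. x \<noteq> 0 \<longrightarrow> (\<exists>y\<in>K. w x y \<noteq> 0))"

lemma nondegenerate_subgroup_diff:
  "nondegenerate_subgroup K \<Longrightarrow> x \<in> K \<Longrightarrow> y \<in> K \<Longrightarrow> x - y \<in> K"
  by (simp add: nondegenerate_subgroup_def)

lemma nondegenerate_subgroup_uminus:
  assumes "nondegenerate_subgroup K" "x \<in> K"
  shows "- x \<in> K"
  using nondegenerate_subgroup_diff[OF assms(1)] assms(2) by (metis diff_self diff_0)

lemma nondegenerate_subgroup_add: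
  assumes "nondegenerate_subgroup K" "x \<in> K" "y \<in> K"
  shows "x + y \<in> K"
  using nondegenerate_subgroup_diff[OF assms(1,2) nondegenerate_subgroup_uminus[OF assms(1,3)]] by simp

text \<open>A group is not the union of two proper subgroups, here the elements of \<open>K\<close>
  orthogonal to \<open>u\<close> and those orthogonal to \<open>v\<close>.\<close>

lemma exists_common_nonorthogonal:
  assumes K: "nondegenerate_subgroup K" and "u \<in> K" "u \<noteq> 0" "v \<in> K" "v \<noteq> 0"
  obtains t where "t \<in> K" "w u t \<noteq> 0" "w v t \<noteq> 0"
proof -
  obtain a b where ab: "a \<in> K" "w u a \<noteq> 0" "b \<in> K" "w v b \<noteq> 0"
    using assms unfolding nondegenerate_subgroup_def by blast
  consider "w v a \<noteq> 0" | "w u b \<noteq> 0" | "w v a = 0" "w u b = 0"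
    by blast
  then show ?thesis
  proof cases
    case 3
    then have "w u (a + b) \<noteq> 0" "w v (a + b) \<noteq> 0"
      using ab by (simp_all add: add_right)
    then show ?thesis
      using that nondegenerate_subgroup_add[OF K] ab by blast
  qed (use that ab in blast)+
qed

text \<open>If \<open>R\<close> contains one element \<open>u\<^sub>0 + z\<close> with \<open>z\<close> orthogonal to \<open>K\<close>, the \<open>K\<close>-component can be
  changed at will, passing through an intermediate value orthogonal to neither endpoint.\<close>

lemma shift_component:
  assumes R: "form_closed R" and K: "nondegenerate_subgroup K" and KR: "K - {0} \<subseteq> R"
    and orth: "\<And>x. x \<in> K \<Longrightarrow> w z x = 0"
    and u\<^sub>0: "u\<^sub>0 \<in> K" "u\<^sub>0 \<noteq> 0" "u\<^sub>0 + z \<in> R"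
    and u: "u \<in> K" "u \<noteq> 0"
  shows "u + z \<in> R"
proof -
  obtain t where t: "t \<in> K" "w u\<^sub>0 t \<noteq> 0" "w u t \<noteq> 0"
    using exists_common_nonorthogonal[OF K u\<^sub>0(1,2) u] .
  \<comment> \<open>Both differences are nonzero: \<open>u\<^sub>0\<close> and \<open>u\<close> are
    orthogonal to themselves but not to \<open>t\<close>.\<close>
  have "t - u\<^sub>0 \<in> R" "u - t \<in> R"
    using t u u\<^sub>0 KR nondegenerate_subgroup_diff[OF K] by auto
  moreover have "w (u\<^sub>0 + z) (t - u\<^sub>0) \<noteq> 0"
    using t orth[OF t(1)] orth[OF u\<^sub>0(1)] by (simp add: form_simps)
  ultimately have "t + z \<in> R"
    using form_closedD[OF R u\<^sub>0(3), of "t - u\<^sub>0"] by (simp add: algebra_simps)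
  moreover have "w (t + z) (u - t) \<noteq> 0"
    using t orth[OF t(1)] orth[OF u(1)] skew[of t u] by (simp add: form_simps)
  ultimately show ?thesis
    using form_closedD[OF R, of "t + z" "u - t"] \<open>u - t \<in> R\<close> by (simp add: algebra_simps)
qed

text \<open>By \<open>shift_component\<close>, the \<open>K\<close>-parts accompanying
  \<open>A\<close> and \<open>- A - B\<close> can be any nonzero elements. Suitable choices produce
  \<open>u - B\<close>, and adding this to vectors with the opposite \<open>K\<close>-part makes
  that part cancel.\<close>

lemma split_off_hyperbolic_pair:
  assumes R: "form_closed R" and K: "nondegenerate_subgroup K" and KR: "K - {0} \<subseteq> R"
    and orth_A: "\<And>x. x \<in> K \<Longrightarrow> w A x = 0" and orth_B: "\<And>x. x \<in> K \<Longrightarrow> w B x = 0"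
    and AB: "w A B = 1"
    and B: "B \<in> R"
    and u\<^sub>0: "u\<^sub>0 \<in> K" "u\<^sub>0 \<noteq> 0" "u\<^sub>0 + A \<in> R"
    and u\<^sub>1: "u\<^sub>1 \<in> K" "u\<^sub>1 \<noteq> 0" "u\<^sub>1 + (- A - B) \<in> R"
  shows "A \<in> R" and "- A - B \<in> R"
proof -
  have orth: "w A x = 0" "w B x = 0" "w x A = 0" "w x B = 0" if "x \<in> K" for x
    using orth_A[OF that] orth_B[OF that] skew[of x A] skew[of x B] by auto
  have BA: "w B A = -1"
    using AB skew[of B A] by simp
  note minus = nondegenerate_subgroup_uminus[OF K] and add = nondegenerate_subgroup_add[OF K]
  have uA: "u + A \<in> R" if "u \<in> K" "u \<noteq> 0" for u
    using shift_component[OF R K KR orth_A u\<^sub>0 that] .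
  have uAB: "u + (- A - B) \<in> R" if "u \<in> K" "u \<noteq> 0" for u
    using shift_component[OF R K KR _ u\<^sub>1 that] orth by (simp add: form_simps)
  have u_B: "u - B \<in> R" if u: "u \<in> K" "u \<noteq> 0" for u
  proof -
    \<comment> \<open>The group might have torsion, so \<open>u + u \<noteq> 0\<close> is deduced
      from nondegeneracy.\<close>
    obtain t where "w u t \<noteq> 0"
      using K u unfolding nondegenerate_subgroup_def by blast
    then have "w (u + u) t \<noteq> 0"
      by (simp add: form_simps)
    then have "u + u \<noteq> 0"
      by auto
    then have "- u + A \<in> R" "u + u + (- A - B) \<in> R"
      using u uA[OF minus] uAB[OF add] by auto
    moreover have "w (- u + A) (u + u + (- A - B)) = -1"
      using u orth AB by (simp add: form_simps)
    ultimately show ?thesis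
      using form_closedD[OF R, of "- u + A" "u + u + (- A - B)"] by (simp add: algebra_simps)
  qed
  have minus_R: "- u\<^sub>0 \<in> K" "- u\<^sub>0 \<noteq> 0"
    using u\<^sub>0 minus by auto
  \<comment> \<open>Adding \<open>B\<close> first ensures that the later summand
    \<open>- u\<^sub>0 - B\<close> cancels both the \<open>K\<close>-part and this extra
    \<open>B\<close>.\<close>
  have "u\<^sub>0 + A + B \<in> R"
    using form_closedD[OF R uA[OF u\<^sub>0(1,2)] B] u\<^sub>0 orth AB by (simp add: form_simps)
  moreover have "w (u\<^sub>0 + A + B) (- u\<^sub>0 - B) = -1"
    using u\<^sub>0 orth AB by (simp add: form_simps)
  ultimately show "A \<in> R"
    using form_closedD[OF R _ u_B[OF minus_R], of "u\<^sub>0 + A + B"] by (simp add: algebra_simps)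
  have "u\<^sub>0 + (- A - B) + B \<in> R"
    using form_closedD[OF R uAB[OF u\<^sub>0(1,2)] B] u\<^sub>0 orth AB by (simp add: form_simps)
  moreover have "w (u\<^sub>0 + (- A - B) + B) (- u\<^sub>0 - B) = 1"
    using u\<^sub>0 orth AB BA by (simp add: form_simps)
  ultimately show "- A - B \<in> R"
    using form_closedD[OF R _ u_B[OF minus_R], of "u\<^sub>0 + (- A - B) + B"] by (simp add: algebra_simps)
qed

end

section \<open>Generation in the standard symplectic lattice\<close>

text \<open>A vector is the sequence of its coordinate pairs in the planes of
  \<open>A\<^sub>i, B\<^sub>i\<close>. All genera share one type; \<open>lattice_upto g\<close>
  singles out the lattice of rank \<open>2 * g\<close>, on which the form is nondegenerate.\<close>

definition symplectic :: "nat \<Rightarrow> (nat \<Rightarrow> int \<times> int) \<Rightarrow> (nat \<Rightarrow> int \<times> int) \<Rightarrow> int" where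
  "symplectic g f h = (\<Sum>i<g. fst (f i) * snd (h i) - snd (f i) * fst (h i))"

interpretation symplectic: skew_form "symplectic g"
proof
  show "symplectic g (x + y) z = symplectic g x z + symplectic g y z" for x y z
    unfolding symplectic_def sum.distrib[symmetric] by (intro sum.cong) (auto simp: algebra_simps)
  show "symplectic g x y = - symplectic g y x" for x y
    unfolding symplectic_def sum_negf[symmetric] by (intro sum.cong) (auto simp: algebra_simps)
qed

definition plane_vec :: "nat \<Rightarrow> int \<Rightarrow> int \<Rightarrow> nat \<Rightarrow> int \<times> int" where
  "plane_vec i k l = (\<lambda>j. if j = i then (k, l) else 0)"

definition lattice_upto :: "nat \<Rightarrow> (nat \<Rightarrow> int \<times> int) set" where
  "lattice_upto n = {f. \<forall>j\<ge>n. f j = 0}"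

lemma symplectic_plane_vec:
  "i < g \<Longrightarrow> symplectic g f (plane_vec i k l) = fst (f i) * l - snd (f i) * k"
  unfolding symplectic_def plane_vec_def
  by (subst sum.cong[OF refl, where h = "\<lambda>j. if j = i then fst (f i) * l - snd (f i) * k else 0"]) auto

lemma plane_vec_add: "plane_vec i k l + plane_vec i k' l' = plane_vec i (k + k') (l + l')"
  by (auto simp: plane_vec_def fun_eq_iff)

lemma plane_vec_diff: "plane_vec i k l - plane_vec i k' l' = plane_vec i (k - k') (l - l')"
  by (auto simp: plane_vec_def fun_eq_iff)

lemma plane_vec_eq_0_iff: "plane_vec i k l = 0 \<longleftrightarrow> k = 0 \<and> l = 0"
  by (auto simp: plane_vec_def fun_eq_iff prod_eq_iff)

lemma nondegenerate_plane:
  assumes "i < g"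
  shows "symplectic.nondegenerate_subgroup g (range (\<lambda>(k, l). plane_vec i k l))"
  unfolding symplectic.nondegenerate_subgroup_def
proof (intro conjI ballI impI)
  fix x y
  assume "x \<in> range (\<lambda>(k, l). plane_vec i k l)" "y \<in> range (\<lambda>(k, l). plane_vec i k l)"
  then show "x - y \<in> range (\<lambda>(k, l). plane_vec i k l)"
    by (auto simp: plane_vec_diff image_iff) blast
next
  fix x
  assume "x \<in> range (\<lambda>(k, l). plane_vec i k l)" "x \<noteq> 0"
  then obtain k l where x: "x = plane_vec i k l" "(k, l) \<noteq> (0, 0)"
    by (auto simp: plane_vec_eq_0_iff)
  \<comment> \<open>A quarter turn of the plane turns the determinant into a sum of squares.\<close>
  have "symplectic g x (plane_vec i (- l) k) = k * k + l * l"
    using assms by (simp add: symplectic_plane_vec x(1)) (simp add: plane_vec_def)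
  moreover have "k * k + l * l \<noteq> 0"
    using x(2) by (simp add: sum_squares_eq_zero_iff)
  moreover have "plane_vec i (- l) k \<in> range (\<lambda>(k, l). plane_vec i k l)"
    by (rule range_eqI[of _ _ "(- l, k)"]) simp
  ultimately show "\<exists>y\<in>range (\<lambda>(k, l). plane_vec i k l). symplectic g x y \<noteq> 0"
    by metis
qed

lemma nondegenerate_lattice_upto:
  assumes "n \<le> g"
  shows "symplectic.nondegenerate_subgroup g (lattice_upto n)"
  unfolding symplectic.nondegenerate_subgroup_def
proof (intro conjI ballI impI)
  fix x
  assume x: "x \<in> lattice_upto n" "x \<noteq> 0"
  then obtain i where i: "x i \<noteq> 0"
    by (auto simp: fun_eq_iff)
  have n: "i < n"
    using i x by (force simp: lattice_upto_def not_less[symmetric])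
  obtain k l where kl: "x i = (k, l)" "(k, l) \<noteq> (0, 0)"
    using i by (metis surj_pair zero_prod_def)
  have "symplectic g x (plane_vec i (- l) k) = k * k + l * l"
    using assms n by (simp add: symplectic_plane_vec kl(1))
  moreover have "k * k + l * l \<noteq> 0"
    using kl(2) by (simp add: sum_squares_eq_zero_iff)
  moreover have "plane_vec i (- l) k \<in> lattice_upto n"
    using n by (auto simp: lattice_upto_def plane_vec_def)
  ultimately show "\<exists>y\<in>lattice_upto n. symplectic g x y \<noteq> 0"
    by force
qed (auto simp: lattice_upto_def)

lemma symplectic_plane_lattice_upto:
  assumes "n \<le> i" "f \<in> lattice_upto n"
  shows "symplectic g (plane_vec i k l) f = 0"
  using assms by (auto simp: symplectic_def plane_vec_def lattice_upto_def intro!: sum.neutral)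

text \<open>Within one plane the form is the determinant, so \<open>plane_generated\<close> applies
  to the coordinates.\<close>

lemma plane_subset_form_closed:
  assumes R: "symplectic.form_closed g R" and i: "i < g"
    and A: "plane_vec i 1 0 \<in> R" and B: "plane_vec i 0 1 \<in> R" and C: "plane_vec i (-1) (-1) \<in> R"
    and nz: "(k, l) \<noteq> (0, 0)"
  shows "plane_vec i k l \<in> R"
proof -
  have "(k, l) \<in> {(k, l). plane_vec i k l \<in> R}"
  proof (rule plane_generated[OF _ _ _ _ nz])
    fix a b c d
    assume *: "(a, b) \<in> {(k, l). plane_vec i k l \<in> R}" "(c, d) \<in> {(k, l). plane_vec i k l \<in> R}"
      "a * d - b * c \<noteq> 0"
    have "symplectic g (plane_vec i a b) (plane_vec i c d) = a * d - b * c"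
      using i by (simp add: symplectic_plane_vec) (simp add: plane_vec_def)
    then show "(a + c, b + d) \<in> {(k, l). plane_vec i k l \<in> R}"
      using * symplectic.form_closedD[OF R, of "plane_vec i a b" "plane_vec i c d"]
      by (simp add: plane_vec_add)
  qed (use A B C in auto)
  then show ?thesis
    by simp
qed

text \<open>With \<open>A\<^sub>i, B\<^sub>i\<close> the standard symplectic basis, \<open>chain_vec i\<close> is \<open>A\<^sub>i - A\<^sub>i\<^sub>-\<^sub>1\<close> (and \<open>A\<^sub>0\<close> for \<open>i = 0\<close>),
  and \<open>closing_vec n\<close> is minus the sum of the \<open>chain_vec i\<close> and the \<open>B\<^sub>i\<close> with \<open>i < n\<close>. In the order
  \<open>A\<^sub>0, B\<^sub>0, A\<^sub>1 - A\<^sub>0, B\<^sub>1, \<dots>\<close>, followed by \<open>closing_vec n\<close>, these \<open>2n + 1\<close> vectors form a cycle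
  in which exactly neighbours have nonzero product.\<close>

definition chain_vec :: "nat \<Rightarrow> nat \<Rightarrow> int \<times> int" where
  "chain_vec i = plane_vec i 1 0 - (if i = 0 then 0 else plane_vec (i - 1) 1 0)"

definition closing_vec :: "nat \<Rightarrow> nat \<Rightarrow> int \<times> int" where
  "closing_vec n = (\<lambda>j. if j < n then (if Suc j = n then (-1, -1) else (0, -1)) else 0)"

text \<open>In the induction step, contracting the cycle gives the lattice \<open>K\<close> of
  smaller genus. The new hyperbolic pair is then split off and fills its plane \<open>W\<close>, and
  sums of nonzero parts from \<open>K\<close> and \<open>W\<close> are reached by shifting one part
  at a time.\<close>

lemma lattice_upto_subset_form_closed:
  assumes R: "symplectic.form_closed g R"
    and "Suc n \<le> g"
    and "\<And>i. i \<le> n \<Longrightarrow> chain_vec i \<in> R"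
    and "\<And>i. i \<le> n \<Longrightarrow> plane_vec i 0 1 \<in> R"
    and "closing_vec (Suc n) \<in> R"
  shows "lattice_upto (Suc n) - {0} \<subseteq> R"
  using assms(2-)
proof (induction n)
  case 0
  have "plane_vec 0 1 0 = chain_vec 0"
    by (simp add: chain_vec_def)
  moreover have "plane_vec 0 (-1) (-1) = closing_vec 1"
    by (auto simp: closing_vec_def plane_vec_def fun_eq_iff)
  ultimately have plane: "plane_vec 0 k l \<in> R" if "(k, l) \<noteq> (0, 0)" for k l
    using plane_subset_form_closed[OF R, of 0 k l] 0 that by simp
  show ?case
  proof
    fix f
    assume f: "f \<in> lattice_upto (Suc 0) - {0}"
    obtain k l where "f 0 = (k, l)"
      by fastforce
    then have "f = plane_vec 0 k l"
      using f by (auto simp: lattice_upto_def plane_vec_def fun_eq_iff)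
    then show "f \<in> R"
      using plane[of k l] f by (auto simp: plane_vec_eq_0_iff)
  qed
next
  case (Suc n)
  define A where "A = plane_vec (Suc n) 1 0"
  define B where "B = plane_vec (Suc n) 0 1"
  define K where "K = lattice_upto (Suc n)"
  have B_in: "B \<in> R" and chain_in: "chain_vec (Suc n) \<in> R"
    using Suc.prems by (simp_all add: B_def)
  \<comment> \<open>Contraction of three consecutive members of the cycle: the closing vector
    absorbs its neighbour \<open>B\<close>, then \<open>chain_vec (Suc n)\<close>, and becomes the
    closing vector of the shorter cycle.\<close>
  have "symplectic g (closing_vec (Suc (Suc n))) B \<noteq> 0"
    using Suc.prems(1) unfolding B_def by (simp add: symplectic_plane_vec) (simp add: closing_vec_def)
  then have "closing_vec (Suc (Suc n)) + B \<in> R"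
    using symplectic.form_closedD[OF R] Suc.prems(4) B_in by blast
  moreover have "symplectic g (closing_vec (Suc (Suc n)) + B) (chain_vec (Suc n)) \<noteq> 0"
    using Suc.prems(1) unfolding B_def
    by (simp add: chain_vec_def symplectic.form_simps symplectic_plane_vec)
      (simp add: closing_vec_def plane_vec_def)
  ultimately have "closing_vec (Suc (Suc n)) + B + chain_vec (Suc n) \<in> R"
    using symplectic.form_closedD[OF R] chain_in by blast
  also have "closing_vec (Suc (Suc n)) + B + chain_vec (Suc n) = closing_vec (Suc n)"
    by (auto simp: fun_eq_iff B_def closing_vec_def plane_vec_def chain_vec_def prod_eq_iff)
  finally have KR: "K - {0} \<subseteq> R"
    unfolding K_def by (intro Suc.IH) (use Suc.prems in auto)
  have K: "symplectic.nondegenerate_subgroup g K"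
    unfolding K_def using nondegenerate_lattice_upto Suc.prems(1) by simp
  have orth: "symplectic g (plane_vec (Suc n) k l) x = 0" if "x \<in> K" for x k l
    using that symplectic_plane_lattice_upto unfolding K_def by blast
  have AB: "symplectic g A B = 1"
    unfolding A_def B_def using Suc.prems(1)
    by (simp add: symplectic_plane_vec) (simp add: plane_vec_def)
  \<comment> \<open>\<open>u\<^sub>0\<close> and \<open>u\<^sub>1\<close> are the
    \<open>K\<close>-components of \<open>chain_vec (Suc n)\<close> and of the closing vector; the
    remaining components are \<open>A\<close> and \<open>- A - B\<close>.\<close>
  define u\<^sub>0 where "u\<^sub>0 = plane_vec n (-1) 0"
  define u\<^sub>1 where "u\<^sub>1 = (\<lambda>j. if j \<le> n then (0, -1) else 0 :: int \<times> int)"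
  have u\<^sub>0: "u\<^sub>0 \<in> K" "u\<^sub>0 \<noteq> 0"
    by (auto simp: u\<^sub>0_def K_def lattice_upto_def plane_vec_eq_0_iff) (simp add: plane_vec_def)
  have u\<^sub>1: "u\<^sub>1 \<in> K" "u\<^sub>1 \<noteq> 0"
    by (auto simp: u\<^sub>1_def K_def lattice_upto_def fun_eq_iff prod_eq_iff intro!: exI[of _ n])
  have u\<^sub>0_A: "u\<^sub>0 + A = chain_vec (Suc n)"
    by (auto simp: u\<^sub>0_def A_def chain_vec_def plane_vec_def fun_eq_iff prod_eq_iff)
  have u\<^sub>1_AB: "u\<^sub>1 + (- A - B) = closing_vec (Suc (Suc n))"
    by (auto simp: u\<^sub>1_def A_def B_def closing_vec_def plane_vec_def fun_eq_iff prod_eq_iff)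
  have "A \<in> R" "- A - B \<in> R"
    using symplectic.split_off_hyperbolic_pair[OF R K KR _ _ AB B_in u\<^sub>0 _ u\<^sub>1]
      orth u\<^sub>0_A u\<^sub>1_AB chain_in Suc.prems(4) unfolding A_def B_def by simp_all
  moreover have "- A - B = plane_vec (Suc n) (-1) (-1)"
    by (auto simp: A_def B_def plane_vec_def fun_eq_iff prod_eq_iff)
  ultimately have plane: "plane_vec (Suc n) k l \<in> R" if "(k, l) \<noteq> (0, 0)" for k l
    using plane_subset_form_closed[OF R, of "Suc n" k l] B_in Suc.prems(1) that
    by (simp add: A_def B_def)
  define W where "W = range (\<lambda>(k, l). plane_vec (Suc n) k l)"
  have W: "symplectic.nondegenerate_subgroup g W"
    unfolding W_def using nondegenerate_plane Suc.prems(1) by simp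
  have WR: "W - {0} \<subseteq> R"
  proof -
    have "plane_vec (Suc n) k l \<in> R" if "plane_vec (Suc n) k l \<noteq> 0" for k l
      using plane[of k l] that by (auto simp: plane_vec_eq_0_iff)
    then show ?thesis
      by (auto simp: W_def)
  qed
  have orth': "symplectic g x z = 0" if "x \<in> K" "z \<in> W" for x z
    using that orth[OF that(1)] symplectic.skew[of g x z] by (auto simp: W_def)
  have A_W: "A \<in> W" "A \<noteq> 0"
    by (auto simp: A_def W_def plane_vec_eq_0_iff)
  show ?case
  proof
    fix f
    assume f: "f \<in> lattice_upto (Suc (Suc n)) - {0}"
    obtain k l where kl: "f (Suc n) = (k, l)"
      by fastforce
    define z where "z = plane_vec (Suc n) k l"
    define u where "u = f - z"
    have u: "u \<in> K"
      unfolding K_def lattice_upto_def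
    proof (intro CollectI allI impI)
      fix j
      assume "Suc n \<le> j"
      then consider "j = Suc n" | "Suc (Suc n) \<le> j"
        by linarith
      then show "u j = 0"
        using f kl by cases (auto simp: u_def z_def plane_vec_def lattice_upto_def)
    qed
    have z: "z \<in> W"
      by (auto simp: z_def W_def)
    have f_eq: "f = u + z"
      by (simp add: u_def)
    show "f \<in> R"
    proof (cases "u = 0 \<or> z = 0")
      case True
      then show ?thesis
        using f f_eq u z KR WR by auto
    next
      case False
      \<comment> \<open>Starting from \<open>A + u\<^sub>0\<close>, which is
        \<open>chain_vec (Suc n)\<close>, the \<open>W\<close>-part moves from \<open>A\<close> to
        \<open>z\<close>; afterwards the \<open>K\<close>-part moves from \<open>u\<^sub>0\<close>
        to \<open>u\<close>.\<close>
      have "z + u\<^sub>0 \<in> R"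
        using symplectic.shift_component[OF R W WR _ A_W _ z] orth' u\<^sub>0 u\<^sub>0_A chain_in False
        by (simp add: add.commute)
      moreover have "symplectic g z x = 0" if "x \<in> K" for x
        using orth'[OF that z] symplectic.skew[of g z x] by simp
      ultimately have "u + z \<in> R"
        using symplectic.shift_component[OF R K KR _ u\<^sub>0 _ u, of z] False
        by (simp add: add.commute)
      then show ?thesis
        using f_eq by simp
    qed
  qed
qed

section \<open>Lie subalgebras spanned by basis elements\<close>

text \<open>The counterpart of \<open>form_closed\<close> for a multiplicatively written group with
  a carrier.\<close>

definition bracket_closed :: "('h, 'b) monoid_scheme \<Rightarrow> ('h \<Rightarrow> 'h \<Rightarrow> int) \<Rightarrow> 'h set \<Rightarrow> bool" where
  "bracket_closed G \<omega> M \<longleftrightarrow>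
     M \<subseteq> carrier G \<and> (\<forall>x\<in>M. \<forall>y\<in>M. \<omega> x y \<noteq> 0 \<longrightarrow> x \<otimes>\<^bsub>G\<^esub> y \<in> M)"

text \<open>A term of the bracket sits at a product \<open>x \<otimes> y\<close> and has coefficient
  zero when \<open>\<omega> x y = 0\<close>, so no support leaves \<open>M\<close>.\<close>

lemma lie_subalgebra_supported:
  assumes M: "bracket_closed G \<omega> M"
  shows "lie_subalgebra G \<omega> {u. Poly_Mapping.keys u \<subseteq> M}"
  unfolding lie_subalgebra_def
proof (intro conjI ballI allI)
  show "{u. Poly_Mapping.keys u \<subseteq> M} \<subseteq> goldman_space G"
    using M by (auto simp: bracket_closed_def goldman_space_def)
next
  fix u v :: "'a \<Rightarrow>\<^sub>0 rat"
  assume uv: "u \<in> {u. Poly_Mapping.keys u \<subseteq> M}" "v \<in> {u. Poly_Mapping.keys u \<subseteq> M}"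
  then show "u + v \<in> {u. Poly_Mapping.keys u \<subseteq> M}"
    using keys_add[of u v] by auto
  have "Poly_Mapping.keys (goldman_bracket G \<omega> u v) \<subseteq>
      (\<Union>x\<in>Poly_Mapping.keys u. \<Union>y\<in>Poly_Mapping.keys v.
        Poly_Mapping.keys (Poly_Mapping.single (x \<otimes>\<^bsub>G\<^esub> y)
          (Poly_Mapping.lookup u x * Poly_Mapping.lookup v y * rat_of_int (\<omega> x y))))"
    unfolding goldman_bracket_def
    by (intro order_trans[OF keys_sum] UN_mono order_refl)
  also have "\<dots> \<subseteq> M"
  proof (intro UN_least)
    fix x y
    assume "x \<in> Poly_Mapping.keys u" "y \<in> Poly_Mapping.keys v"
    then have "x \<in> M" "y \<in> M"
      using uv by auto
    then show "Poly_Mapping.keys (Poly_Mapping.single (x \<otimes>\<^bsub>G\<^esub> y)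
        (Poly_Mapping.lookup u x * Poly_Mapping.lookup v y * rat_of_int (\<omega> x y))) \<subseteq> M"
      using M by (auto simp: bracket_closed_def)
  qed
  finally show "goldman_bracket G \<omega> u v \<in> {u. Poly_Mapping.keys u \<subseteq> M}"
    by simp
next
  fix q and u :: "'a \<Rightarrow>\<^sub>0 rat"
  assume "u \<in> {u. Poly_Mapping.keys u \<subseteq> M}"
  moreover have "Poly_Mapping.keys (Poly_Mapping.map ((*) q) u) \<subseteq> Poly_Mapping.keys u"
    by (auto simp: in_keys_iff Poly_Mapping.map.rep_eq when_def)
  ultimately show "Poly_Mapping.map ((*) q) u \<in> {u. Poly_Mapping.keys u \<subseteq> M}"
    by auto
qed auto

lemma map_times_single:
  "Poly_Mapping.map ((*) q) (Poly_Mapping.single x (c :: rat)) = Poly_Mapping.single x (q * c)"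
  by (rule poly_mapping_eqI) (auto simp: Poly_Mapping.map.rep_eq lookup_single when_def)

text \<open>The bracket of two basis elements is an integer multiple of a third; a nonzero integer
  can be divided out over the rationals.\<close>

lemma bracket_closed_basis_elts:
  assumes G: "monoid G" and L: "lie_subalgebra G \<omega> L"
  shows "bracket_closed G \<omega> {x \<in> carrier G. basis_elt x \<in> L}"
proof -
  have "basis_elt (x \<otimes>\<^bsub>G\<^esub> y) \<in> L" if "basis_elt x \<in> L" "basis_elt y \<in> L" "\<omega> x y \<noteq> 0" for x y
  proof -
    have "Poly_Mapping.map ((*) (rat_of_int (\<omega> x y))) (basis_elt (x \<otimes>\<^bsub>G\<^esub> y)) \<in> L"
      using L that(1,2) unfolding lie_subalgebra_def by (metis goldman_bracket_basis)
    then have "Poly_Mapping.map ((*) (inverse (rat_of_int (\<omega> x y))))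
        (Poly_Mapping.map ((*) (rat_of_int (\<omega> x y))) (basis_elt (x \<otimes>\<^bsub>G\<^esub> y))) \<in> L"
      using L unfolding lie_subalgebra_def by blast
    then show ?thesis
      using that(3) by (simp add: basis_elt_def map_times_single)
  qed
  then show ?thesis
    using G by (auto simp: bracket_closed_def monoid.m_closed)
qed

lemma goldman_space_subset_lie_subalgebra:
  assumes L: "lie_subalgebra G \<omega> L" and basis: "\<And>x. x \<in> carrier G \<Longrightarrow> basis_elt x \<in> L"
  shows "goldman_space G \<subseteq> L"
proof
  fix u :: "'a \<Rightarrow>\<^sub>0 rat"
  assume u: "u \<in> goldman_space G"
  have "(\<Sum>x\<in>A. Poly_Mapping.single x (Poly_Mapping.lookup u x)) \<in> L"
    if "finite A" "A \<subseteq> carrier G" for A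
    using that
  proof (induction A)
    case empty
    then show ?case
      using L by (simp add: lie_subalgebra_def)
  next
    case (insert x A)
    have "Poly_Mapping.map ((*) (Poly_Mapping.lookup u x)) (basis_elt x) \<in> L"
      using L basis insert.prems unfolding lie_subalgebra_def by blast
    then have "Poly_Mapping.single x (Poly_Mapping.lookup u x) \<in> L"
      by (simp add: basis_elt_def map_times_single)
    then show ?case
      using insert L by (simp add: lie_subalgebra_def)
  qed
  then have "(\<Sum>x\<in>Poly_Mapping.keys u. Poly_Mapping.single x (Poly_Mapping.lookup u x)) \<in> L"
    using u by (simp add: goldman_space_def)
  also have "(\<Sum>x\<in>Poly_Mapping.keys u. Poly_Mapping.single x (Poly_Mapping.lookup u x)) = u"
    by (rule poly_mapping_eqI) (auto simp: lookup_sum lookup_single when_def in_keys_iff sum.delta')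
  finally show "u \<in> L" .
qed

text \<open>Reduces Lie generation to combinatorics: a closed \<open>M\<close> yields the subalgebra
  of elements supported on \<open>M\<close>, and a subalgebra \<open>L\<close> yields the closed set
  of all \<open>x\<close> with \<open>[x]\<close> in \<open>L\<close>.\<close>

lemma generates_goldman_basis_iff:
  assumes G: "monoid G" and S: "S \<subseteq> carrier G"
  shows "generates_goldman G \<omega> (basis_elt ` S) \<longleftrightarrow>
    (\<forall>M. bracket_closed G \<omega> M \<and> S \<subseteq> M \<longrightarrow> M = carrier G)"
proof
  assume gen: "generates_goldman G \<omega> (basis_elt ` S)"
  show "\<forall>M. bracket_closed G \<omega> M \<and> S \<subseteq> M \<longrightarrow> M = carrier G"
  proof (intro allI impI)
    fix M
    assume M: "bracket_closed G \<omega> M \<and> S \<subseteq> M"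
    then have "goldman_space G \<subseteq> {u. Poly_Mapping.keys u \<subseteq> M}"
      using gen lie_subalgebra_supported[of G \<omega> M]
      unfolding generates_goldman_def by (fastforce simp: basis_elt_def)
    moreover have "basis_elt x \<in> goldman_space G" if "x \<in> carrier G" for x
      using that by (simp add: goldman_space_def basis_elt_def)
    ultimately have "carrier G \<subseteq> M"
      by (fastforce simp: basis_elt_def)
    then show "M = carrier G"
      using M by (auto simp: bracket_closed_def)
  qed
next
  assume closed: "\<forall>M. bracket_closed G \<omega> M \<and> S \<subseteq> M \<longrightarrow> M = carrier G"
  have "bracket_closed G \<omega> (carrier G)"
    using G by (simp add: bracket_closed_def monoid.m_closed)
  then have space: "lie_subalgebra G \<omega> (goldman_space G)"
    using lie_subalgebra_supported unfolding goldman_space_def by blast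
  have S_space: "basis_elt ` S \<subseteq> goldman_space G"
    using S by (auto simp: goldman_space_def basis_elt_def)
  have "goldman_space G \<subseteq> L" if L: "lie_subalgebra G \<omega> L" "basis_elt ` S \<subseteq> L" for L
  proof (rule goldman_space_subset_lie_subalgebra[OF L(1)])
    have "{x \<in> carrier G. basis_elt x \<in> L} = carrier G"
      using closed bracket_closed_basis_elts[OF G L(1)] L(2) S by blast
    then show "basis_elt x \<in> L" if "x \<in> carrier G" for x
      using that by blast
  qed
  then show "generates_goldman G \<omega> (basis_elt ` S)"
    unfolding generates_goldman_def using space S_space by blast
qed

section \<open>Free abelian groups of finite rank\<close>

lemma sum_fun_apply: "(\<Sum>s\<in>S. f s) i = (\<Sum>s\<in>S. f s i)"
  by (induction S rule: infinite_finite_induct) auto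

text \<open>Coordinate vectors are compared here, where the size of a spanning set is bounded below
  by the number of independent unit vectors.\<close>

interpretation rat_fun: vector_space "\<lambda>(q::rat) (f::'i \<Rightarrow> rat) i. q * f i"
  by unfold_locales (auto simp: fun_eq_iff algebra_simps)

lemma rat_fun_independent_deltas:
  assumes "finite I"
  shows "rat_fun.independent ((\<lambda>i j. if j = i then 1 else 0) ` I)"
    and "inj_on (\<lambda>i j. if j = i then 1 else (0::rat)) I"
proof -
  let ?d = "\<lambda>i j. if j = i then 1 else (0::rat)"
  show inj: "inj_on ?d I"
    by (rule inj_onI) (metis zero_neq_one)
  show "rat_fun.independent (?d ` I)"
  proof (rule rat_fun.independent_if_scalars_zero)
    fix c x
    assume sum0: "(\<Sum>x\<in>?d ` I. (\<lambda>i. c x * x i)) = 0" and "x \<in> ?d ` I"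
    then obtain i where i: "i \<in> I" "x = ?d i"
      by blast
    have "0 = (\<Sum>x\<in>?d ` I. (\<lambda>i. c x * x i)) i"
      using sum0 by simp
    also have "\<dots> = (\<Sum>k\<in>I. c (?d k) * ?d k i)"
      by (simp add: sum.reindex[OF inj] sum_fun_apply)
    also have "\<dots> = c x"
      using i assms by (simp add: if_distrib[of "(*) _"] sum.delta' cong: if_cong)
    finally show "c x = 0"
      by simp
  qed (use assms in simp)
qed

section \<open>Skew forms on multiplicatively written groups\<close>

lemma skew_bilinear_add_left:
  assumes "skew_bilinear G \<omega>" "x \<in> carrier G" "y \<in> carrier G" "z \<in> carrier G"
  shows "\<omega> (x \<otimes>\<^bsub>G\<^esub> y) z = \<omega> x z + \<omega> y z"
  using assms unfolding skew_bilinear_def by blast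

lemma skew_bilinear_skew:
  assumes "skew_bilinear G \<omega>" "x \<in> carrier G" "y \<in> carrier G"
  shows "\<omega> x y = - \<omega> y x"
  using assms unfolding skew_bilinear_def by blast

lemma skew_bilinear_one_left:
  assumes "monoid G" "skew_bilinear G \<omega>" "y \<in> carrier G"
  shows "\<omega> \<one>\<^bsub>G\<^esub> y = 0"
proof -
  have "\<omega> (\<one>\<^bsub>G\<^esub> \<otimes>\<^bsub>G\<^esub> \<one>\<^bsub>G\<^esub>) y = \<omega> \<one>\<^bsub>G\<^esub> y + \<omega> \<one>\<^bsub>G\<^esub> y"
    by (rule skew_bilinear_add_left) (use assms monoid.one_closed in auto)
  then show ?thesis
    using assms(1) by (simp add: monoid.l_one monoid.one_closed)
qed

lemma skew_bilinear_int_pow_left: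
  fixes k :: int
  assumes "group G" "skew_bilinear G \<omega>" "x \<in> carrier G" "y \<in> carrier G"
  shows "\<omega> (x [^]\<^bsub>G\<^esub> k) y = k * \<omega> x y"
proof -
  interpret group G by fact
  have step: "\<omega> (x [^]\<^bsub>G\<^esub> (k + 1)) y = \<omega> (x [^]\<^bsub>G\<^esub> k) y + \<omega> x y" for k :: int
  proof -
    have "\<omega> (x [^]\<^bsub>G\<^esub> k \<otimes>\<^bsub>G\<^esub> x) y = \<omega> (x [^]\<^bsub>G\<^esub> k) y + \<omega> x y"
      by (rule skew_bilinear_add_left) (use assms int_pow_closed in auto)
    then show ?thesis
      using assms(3) by (simp add: int_pow_mult)
  qed
  show ?thesis
  proof (induction k rule: int_induct[of _ 0])
    case base
    then show ?case
      using skew_bilinear_one_left[of G \<omega> y] assms is_monoid by simp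
  next
    case (step1 k)
    then show ?case
      using step[of k] by (simp add: algebra_simps)
  next
    case (step2 k)
    then show ?case
      using step[of "k - 1"] by (simp add: algebra_simps)
  qed
qed

section \<open>Coordinates with respect to a Z-basis\<close>

locale Z_basis_group = comm_group G for G (structure) +
  fixes I :: "'i set" and e
  assumes Z_basis: "Z_basis G I e"
begin

text \<open>Total coefficient functions can be added pointwise; values outside \<open>I\<close> are
  ignored, so uniqueness holds on \<open>I\<close> only.\<close>

definition Z_comb :: "('i \<Rightarrow> int) \<Rightarrow> 'a" where
  "Z_comb f = (\<Otimes>i\<in>I. e i [^] f i)"

lemma finite_index: "finite I"
  using Z_basis by (simp add: Z_basis_def)

lemma basis_closed [simp]: "i \<in> I \<Longrightarrow> e i \<in> carrier G"
  using Z_basis by (auto simp: Z_basis_def)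

lemma Z_comb_closed [simp]: "Z_comb f \<in> carrier G"
  unfolding Z_comb_def by (rule finprod_closed) auto

lemma Z_comb_add: "Z_comb (f + h) = Z_comb f \<otimes> Z_comb h"
proof -
  have "Z_comb (f + h) = (\<Otimes>i\<in>I. e i [^] f i \<otimes> e i [^] h i)"
    unfolding Z_comb_def by (rule finprod_cong) (auto simp: int_pow_mult simp_implies_def)
  also have "\<dots> = Z_comb f \<otimes> Z_comb h"
    unfolding Z_comb_def by (rule finprod_multf) auto
  finally show ?thesis .
qed

lemma Z_comb_zero [simp]: "Z_comb 0 = \<one>"
  unfolding Z_comb_def by (rule finprod_one_eqI) simp

lemma Z_comb_restrict: "Z_comb (restrict f I) = Z_comb f"
  unfolding Z_comb_def by (rule finprod_cong) auto

lemma Z_comb_surj: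
  assumes "x \<in> carrier G"
  shows "\<exists>f. x = Z_comb f"
  using assms Z_basis unfolding Z_basis_def Z_comb_def by blast

lemma Z_comb_eqD:
  assumes "Z_comb f = Z_comb h" "i \<in> I"
  shows "f i = h i"
proof -
  have "\<exists>!n. n \<in> extensional I \<and> Z_comb f = Z_comb n"
    using Z_basis Z_comb_closed[of f] unfolding Z_basis_def Z_comb_def[symmetric] by blast
  then have "restrict f I = restrict h I"
    using assms(1) Z_comb_restrict restrict_extensional by metis
  then show ?thesis
    using assms(2) by (metis restrict_apply')
qed

lemma Z_comb_delta:
  assumes "i \<in> I"
  shows "Z_comb (\<lambda>j. if j = i then 1 else 0) = e i"
proof -
  have "Z_comb (\<lambda>j. if j = i then 1 else 0) = (\<Otimes>j\<in>I. if i = j then e j else \<one>)"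
    unfolding Z_comb_def by (rule finprod_cong) (auto simp: assms simp_implies_def)
  then show ?thesis
    using assms finite_index finprod_singleton[of i I e] by auto
qed

lemma form_Z_comb_left:
  assumes \<omega>: "skew_bilinear G \<omega>" and y: "y \<in> carrier G"
  shows "\<omega> (Z_comb f) y = (\<Sum>i\<in>I. f i * \<omega> (e i) y)"
proof -
  have "\<omega> (\<Otimes>i\<in>J. e i [^] f i) y = (\<Sum>i\<in>J. f i * \<omega> (e i) y)" if "finite J" "J \<subseteq> I" for J
    using that
  proof (induction J)
    case empty
    then show ?case
      using skew_bilinear_one_left[OF is_monoid \<omega> y] by simp
  next
    case (insert j J)
    have closed: "(\<Otimes>i\<in>J. e i [^] f i) \<in> carrier G" "e j [^] f j \<in> carrier G"
      using insert.prems by (auto intro!: finprod_closed)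
    have "(\<Otimes>i\<in>insert j J. e i [^] f i) = e j [^] f j \<otimes> (\<Otimes>i\<in>J. e i [^] f i)"
      using insert.hyps insert.prems by (intro finprod_insert) auto
    moreover have "\<omega> (e j [^] f j \<otimes> (\<Otimes>i\<in>J. e i [^] f i)) y =
        \<omega> (e j [^] f j) y + \<omega> (\<Otimes>i\<in>J. e i [^] f i) y"
      by (rule skew_bilinear_add_left[OF \<omega> closed(2,1) y])
    moreover have "\<omega> (e j [^] f j) y = f j * \<omega> (e j) y"
      using skew_bilinear_int_pow_left[OF is_group \<omega> _ y] insert.prems by simp
    ultimately show ?case
      using insert by simp
  qed
  then show ?thesis
    unfolding Z_comb_def using finite_index by blast
qed

lemma form_Z_comb:
  assumes \<omega>: "skew_bilinear G \<omega>"
  shows "\<omega> (Z_comb f) (Z_comb h) = (\<Sum>i\<in>I. \<Sum>j\<in>I. f i * h j * \<omega> (e i) (e j))"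
proof -
  have "\<omega> (e i) (Z_comb h) = (\<Sum>j\<in>I. h j * \<omega> (e i) (e j))" if "i \<in> I" for i
  proof -
    have "\<omega> (e i) (Z_comb h) = - (\<Sum>j\<in>I. h j * \<omega> (e j) (e i))"
      using form_Z_comb_left[OF \<omega>, of "e i" h] skew_bilinear_skew[OF \<omega>, of "e i" "Z_comb h"] that by simp
    also have "\<dots> = (\<Sum>j\<in>I. h j * \<omega> (e i) (e j))"
      unfolding sum_negf[symmetric]
    proof (intro sum.cong refl)
      fix j
      assume "j \<in> I"
      then show "- (h j * \<omega> (e j) (e i)) = h j * \<omega> (e i) (e j)"
        using skew_bilinear_skew[OF \<omega>, of "e i" "e j"] that by simp
    qed
    finally show ?thesis .
  qed
  then show ?thesis
    using form_Z_comb_left[OF \<omega>, of "Z_comb h" f] by (simp add: sum_distrib_left mult.assoc)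
qed

text \<open>Expressing the inverse of the product of all generators gives a linear relation between
  them with positive coefficients, so over the rationals one generator can be dropped.\<close>

lemma card_monoid_generators:
  assumes S: "finite S" "S \<subseteq> carrier G" and "I \<noteq> {}"
    and gen: "\<And>M. S \<subseteq> M \<Longrightarrow> M \<subseteq> carrier G \<Longrightarrow> \<one> \<in> M \<Longrightarrow>
      (\<And>x y. x \<in> M \<Longrightarrow> y \<in> M \<Longrightarrow> x \<otimes> y \<in> M) \<Longrightarrow> M = carrier G"
  shows "card I < card S"
proof -
  have "\<exists>f. s = Z_comb f \<and> (\<forall>i. i \<notin> I \<longrightarrow> f i = 0)" if s: "s \<in> S" for s
  proof -
    obtain f where f: "s = Z_comb f"
      using Z_comb_surj[of s] S(2) s by auto
    have "Z_comb f = Z_comb (\<lambda>i. if i \<in> I then f i else 0)"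
      unfolding Z_comb_def by (rule finprod_cong) (auto simp: simp_implies_def)
    then show ?thesis
      using f by (intro exI[of _ "\<lambda>i. if i \<in> I then f i else 0"]) simp
  qed
  then obtain v where v: "\<And>s. s \<in> S \<Longrightarrow> s = Z_comb (v s)" "\<And>s i. s \<in> S \<Longrightarrow> i \<notin> I \<Longrightarrow> v s i = 0"
    by metis
  \<comment> \<open>Natural coefficients: the \<open>comb c\<close> are the coordinates of the
    submonoid generated by \<open>S\<close>.\<close>
  define comb where "comb c = (\<lambda>i. \<Sum>s\<in>S. int (c s) * v s i)" for c :: "'a \<Rightarrow> nat"
  have comb_outside: "comb c i = 0" if "i \<notin> I" for c i
    using that v(2) by (simp add: comb_def)
  have "range (\<lambda>c. Z_comb (comb c)) = carrier G"
  proof (rule gen)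
    show "S \<subseteq> range (\<lambda>c. Z_comb (comb c))"
    proof
      fix s
      assume s: "s \<in> S"
      have "comb (\<lambda>t. if t = s then 1 else 0) = v s"
        using s S(1) by (simp add: comb_def if_distrib[of int] if_distrib[of "\<lambda>x. x * _"] cong: if_cong)
      then have "s = Z_comb (comb (\<lambda>t. if t = s then 1 else 0))"
        using v(1)[OF s] by simp
      then show "s \<in> range (\<lambda>c. Z_comb (comb c))"
        by - (rule range_eqI)
    qed
    have "comb (\<lambda>_. 0) = 0"
      by (auto simp: comb_def)
    then have "\<one> = Z_comb (comb (\<lambda>_. 0))"
      by simp
    then show "\<one> \<in> range (\<lambda>c. Z_comb (comb c))"
      by - (rule range_eqI)
    fix x y
    assume "x \<in> range (\<lambda>c. Z_comb (comb c))" "y \<in> range (\<lambda>c. Z_comb (comb c))"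
    then obtain c c' where xy: "x = Z_comb (comb c)" "y = Z_comb (comb c')"
      by blast
    have "comb (\<lambda>s. c s + c' s) = comb c + comb c'"
      by (auto simp: comb_def sum.distrib algebra_simps)
    then have "x \<otimes> y = Z_comb (comb (\<lambda>s. c s + c' s))"
      by (simp add: xy Z_comb_add)
    then show "x \<otimes> y \<in> range (\<lambda>c. Z_comb (comb c))"
      by - (rule range_eqI)
  qed auto
  then have "Z_comb f \<in> range (\<lambda>c. Z_comb (comb c))" for f
    by simp
  \<comment> \<open>Both sides vanish outside \<open>I\<close>, which upgrades equality of group
    elements to equality of functions.\<close>
  then have repr: "\<exists>c. f = comb c" if f: "\<And>i. i \<notin> I \<Longrightarrow> f i = 0" for f
  proof -
    obtain c where c: "Z_comb f = Z_comb (comb c)"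
      using \<open>Z_comb f \<in> range (\<lambda>c. Z_comb (comb c))\<close> by (rule rangeE)
    have "f i = comb c i" for i
      using f[of i] comb_outside[of i c] Z_comb_eqD[OF c, of i] by (cases "i \<in> I") auto
    then show ?thesis
      by (intro exI ext)
  qed
  define V where "V s = (\<lambda>i. rat_of_int (v s i))" for s
  let ?d = "\<lambda>i j. if j = i then 1 else (0::rat)"
  have delta_in: "?d i \<in> rat_fun.span (V ` S)" if "i \<in> I" for i
  proof -
    have "\<exists>c. (\<lambda>j. if j = i then 1 else 0) = comb c"
      by (rule repr) (use that in auto)
    then obtain c where c: "(\<lambda>j. if j = i then 1 else 0) = comb c"
      by (rule exE)
    have "?d i j = (\<Sum>s\<in>S. (\<lambda>j. rat_of_nat (c s) * V s j)) j" for j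
    proof -
      have "?d i j = rat_of_int (comb c j)"
        by (simp flip: c)
      then show ?thesis
        by (simp add: comb_def V_def sum_fun_apply)
    qed
    then have "?d i = (\<Sum>s\<in>S. (\<lambda>j. rat_of_nat (c s) * V s j))"
      by (rule ext)
    then show ?thesis
      by (simp only:) (intro rat_fun.span_sum rat_fun.span_scale rat_fun.span_base imageI)
  qed
  have "S \<noteq> {}"
  proof
    assume "S = {}"
    then have comb0: "comb c = 0" for c
      by (auto simp: comb_def)
    obtain i where i: "i \<in> I"
      using \<open>I \<noteq> {}\<close> by blast
    have "\<exists>c. (\<lambda>j. if j = i then 1 else 0) = comb c"
      by (rule repr) (use i in auto)
    then obtain c where "(\<lambda>j. if j = i then 1 else 0) = comb c"
      by (rule exE)
    from fun_cong[OF this, of i] show False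
      by (simp add: comb0)
  qed
  then obtain s\<^sub>0 where s\<^sub>0: "s\<^sub>0 \<in> S"
    by blast
  have "\<exists>c. (\<lambda>i. - (\<Sum>s\<in>S. v s i)) = comb c"
    by (rule repr) (simp add: v(2))
  then obtain c where c: "(\<lambda>i. - (\<Sum>s\<in>S. v s i)) = comb c"
    by (rule exE)
  \<comment> \<open>The \<open>1\<close> comes from moving the negated sum to the other side: the
    relation has coefficients \<open>c s + 1\<close>, all positive, so it can be solved for
    \<open>V s\<^sub>0\<close>.\<close>
  define q where "q s = rat_of_nat (c s) + 1" for s
  have "V s\<^sub>0 i = (\<Sum>s\<in>S - {s\<^sub>0}. (\<lambda>j. (- q s / q s\<^sub>0) * V s j)) i" for i
  proof -
    have "(\<Sum>s\<in>S. (int (c s) + 1) * v s i) = 0"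
      using fun_cong[OF c, of i] by (simp add: comb_def sum.distrib algebra_simps)
    then have "rat_of_int (\<Sum>s\<in>S. (int (c s) + 1) * v s i) = 0"
      by simp
    then have "(\<Sum>s\<in>S. q s * V s i) = 0"
      by (simp add: V_def q_def)
    then have sum0: "q s\<^sub>0 * V s\<^sub>0 i + (\<Sum>s\<in>S - {s\<^sub>0}. q s * V s i) = 0"
      using s\<^sub>0 S(1) by (simp add: sum.remove)
    have "q s\<^sub>0 > 0"
      by (simp add: q_def add_nonneg_pos)
    then have "V s\<^sub>0 i = - (\<Sum>s\<in>S - {s\<^sub>0}. q s * V s i) / q s\<^sub>0"
      using sum0 by (simp add: field_simps)
    then show ?thesis
      by (simp add: sum_fun_apply sum_divide_distrib sum_negf)
  qed
  then have "V s\<^sub>0 = (\<Sum>s\<in>S - {s\<^sub>0}. (\<lambda>j. (- q s / q s\<^sub>0) * V s j))"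
    by (rule ext)
  moreover have "(\<Sum>s\<in>S - {s\<^sub>0}. (\<lambda>j. (- q s / q s\<^sub>0) * V s j)) \<in> rat_fun.span (V ` (S - {s\<^sub>0}))"
    by (intro rat_fun.span_sum rat_fun.span_scale rat_fun.span_base imageI)
  ultimately have "V s\<^sub>0 \<in> rat_fun.span (V ` (S - {s\<^sub>0}))"
    by simp
  then have "V ` S \<subseteq> rat_fun.span (V ` (S - {s\<^sub>0}))"
    by (auto intro: rat_fun.span_base)
  then have "?d ` I \<subseteq> rat_fun.span (V ` (S - {s\<^sub>0}))"
    using delta_in rat_fun.span_minimal[OF _ rat_fun.subspace_span] by blast
  then have "card (?d ` I) \<le> card (V ` (S - {s\<^sub>0}))"
    using rat_fun.independent_span_bound[OF _ rat_fun_independent_deltas(1)[OF finite_index]] S(1) by simp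
  also have "\<dots> \<le> card (S - {s\<^sub>0})"
    using S(1) by (intro card_image_le) auto
  also have "\<dots> < card S"
    using S(1) s\<^sub>0 by (intro psubset_card_mono) auto
  finally show ?thesis
    using card_image[OF rat_fun_independent_deltas(2)[OF finite_index]] by simp
qed

end

text \<open>Of the two extra generators, one is the identity and the other is forced by
  \<open>card_monoid_generators\<close> applied to the rest.\<close>

lemma card_goldman_generators:
  assumes "Z_basis_group G I e" and "I \<noteq> {}" and \<omega>: "skew_bilinear G \<omega>"
    and S: "finite S" "S \<subseteq> carrier G" and gen: "generates_goldman G \<omega> (basis_elt ` S)"
  shows "card I + 2 \<le> card S"
proof -
  interpret Z_basis_group G I e by fact
  have closed: "M = carrier G" if "bracket_closed G \<omega> M" "S \<subseteq> M" for M
    using gen generates_goldman_basis_iff[OF is_monoid S(2)] that by blast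
  \<comment> \<open>Here \<open>y\<close> is the inverse of \<open>x\<close>, so the form takes the
    value \<open>- \<omega> x x = 0\<close>.\<close>
  have "\<omega> x y = 0" if "x \<in> carrier G" "y \<in> carrier G" "x \<otimes>\<^bsub>G\<^esub> y = \<one>\<^bsub>G\<^esub>" for x y
  proof -
    have "\<omega> x x + \<omega> y x = 0"
      using skew_bilinear_one_left[OF is_monoid \<omega> that(1)] that(3)
        skew_bilinear_add_left[OF \<omega> that(1,2,1)] by simp
    then show ?thesis
      using skew_bilinear_skew[OF \<omega> that(1,1)] skew_bilinear_skew[OF \<omega> that(1,2)] by linarith
  qed
  then have "bracket_closed G \<omega> (carrier G - {\<one>\<^bsub>G\<^esub>})"
    by (auto simp: bracket_closed_def)
  then have one: "\<one>\<^bsub>G\<^esub> \<in> S"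
    using closed[of "carrier G - {\<one>\<^bsub>G\<^esub>}"] S(2) one_closed by blast
  \<comment> \<open>A submonoid containing the other generators contains \<open>S\<close> and is
    bracket closed, hence is everything.\<close>
  have "card I < card (S - {\<one>\<^bsub>G\<^esub>})"
  proof (rule card_monoid_generators)
    fix M
    assume "S - {\<one>\<^bsub>G\<^esub>} \<subseteq> M" "M \<subseteq> carrier G" "\<one>\<^bsub>G\<^esub> \<in> M"
      and "\<And>x y. x \<in> M \<Longrightarrow> y \<in> M \<Longrightarrow> x \<otimes>\<^bsub>G\<^esub> y \<in> M"
    then show "M = carrier G"
      by (intro closed) (auto simp: bracket_closed_def)
  qed (use S \<open>I \<noteq> {}\<close> in auto)
  then show ?thesis
    using one S(1) by simp
qed

section \<open>Symplectic bases of the homology of a surface\<close>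

text \<open>The coordinate map \<open>\<phi>\<close> from the standard lattice preserves sums and
  forms, so bracket closed sets pull back to form closed ones. Only an upper bound on the
  cardinality is claimed; the general lower bound later makes it an equality.\<close>

lemma symplectic_goldman_generators:
  fixes e :: "nat + nat + 'c \<Rightarrow> 'h"
  assumes "Z_basis_group G ({..<g} <+> {..<g} <+> {}) e" and \<omega>: "skew_bilinear G \<omega>" and g: "g \<ge> 1"
    and AA: "\<And>i j. i < g \<Longrightarrow> j < g \<Longrightarrow> \<omega> (e (Inl i)) (e (Inl j)) = 0"
    and BB: "\<And>i j. i < g \<Longrightarrow> j < g \<Longrightarrow> \<omega> (e (Inr (Inl i))) (e (Inr (Inl j))) = 0"
    and AB: "\<And>i j. i < g \<Longrightarrow> j < g \<Longrightarrow> \<omega> (e (Inl i)) (e (Inr (Inl j))) = (if i = j then 1 else 0)"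
  shows "\<exists>S \<subseteq> carrier G. finite S \<and> card S \<le> 2 * g + 2 \<and> generates_goldman G \<omega> (basis_elt ` S)"
proof -
  let ?I = "{..<g} <+> {..<g} <+> ({} :: 'c set)"
  interpret Z_basis_group G ?I e by fact
  define coeffs where "coeffs f = case_sum (fst \<circ> f) (case_sum (snd \<circ> f) (\<lambda>_ :: 'c. 0))"
    for f :: "nat \<Rightarrow> int \<times> int"
  define \<phi> where "\<phi> f = Z_comb (coeffs f)" for f
  have \<phi>_closed: "\<phi> f \<in> carrier G" for f
    by (simp add: \<phi>_def)
  have \<phi>_add: "\<phi> (f + h) = \<phi> f \<otimes>\<^bsub>G\<^esub> \<phi> h" for f h
  proof -
    have "coeffs (f + h) = coeffs f + coeffs h"
      by (auto simp: coeffs_def fun_eq_iff split: sum.split)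
    then show ?thesis
      by (simp add: \<phi>_def Z_comb_add)
  qed
  have \<phi>_surj: "\<exists>f \<in> lattice_upto g. x = \<phi> f" if x: "x \<in> carrier G" for x
  proof -
    obtain n where n: "x = Z_comb n"
      using Z_comb_surj[OF x] by blast
    define f where "f i = (if i < g then (n (Inl i), n (Inr (Inl i))) else 0)" for i
    have "Z_comb n = \<phi> f"
      unfolding Z_comb_def \<phi>_def by (rule finprod_cong) (auto simp: f_def coeffs_def simp_implies_def)
    moreover have "f \<in> lattice_upto g"
      by (simp add: f_def lattice_upto_def)
    ultimately show ?thesis
      using n by blast
  qed
  have BA: "\<omega> (e (Inr (Inl i))) (e (Inl j)) = (if i = j then -1 else 0)" if "i < g" "j < g" for i j
  proof -
    have "e (Inr (Inl i)) \<in> carrier G" "e (Inl j) \<in> carrier G"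
      using that by (auto intro!: basis_closed)
    then show ?thesis
      using AB[OF that(2,1)] skew_bilinear_skew[OF \<omega>, of "e (Inr (Inl i))" "e (Inl j)"] by auto
  qed
  have form: "\<omega> (\<phi> f) (\<phi> h) = symplectic g f h" for f h
  proof -
    have "\<omega> (\<phi> f) (\<phi> h) =
        (\<Sum>i<g. \<Sum>j<g. fst (f i) * snd (h j) * \<omega> (e (Inl i)) (e (Inr (Inl j)))) +
        (\<Sum>i<g. \<Sum>j<g. snd (f i) * fst (h j) * \<omega> (e (Inr (Inl i))) (e (Inl j)))"
      unfolding \<phi>_def form_Z_comb[OF \<omega>]
      by (simp add: sum.Plus coeffs_def AA BB)
    also have "\<dots> = symplectic g f h"
      by (simp add: AB BA symplectic_def if_distrib[of "(*) _"] sum.delta sum.delta' sum_subtractf sum_negf cong: if_cong)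
    finally show ?thesis .
  qed
  \<comment> \<open>The cycle of \<open>2 * g + 1\<close> vectors, together with \<open>0\<close>,
    which sums of non-orthogonal vectors never produce.\<close>
  define S where "S = insert 0 (insert (closing_vec g) (chain_vec ` {..<g} \<union> (\<lambda>i. plane_vec i 0 1) ` {..<g}))"
  have fin: "finite S"
    by (simp add: S_def)
  have "card (chain_vec ` {..<g} \<union> (\<lambda>i. plane_vec i 0 1) ` {..<g}) \<le> g + g"
    by (intro order_trans[OF card_Un_le] add_mono order_trans[OF card_image_le]) auto
  then have "card S \<le> 2 * g + 2"
    unfolding S_def by (simp add: card_insert_if)
  then have card: "card (\<phi> ` S) \<le> 2 * g + 2"
    using card_image_le[OF fin, of \<phi>] by linarith
  have S_carrier: "\<phi> ` S \<subseteq> carrier G"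
    using \<phi>_closed by blast
  have "M = carrier G" if M: "bracket_closed G \<omega> M" "\<phi> ` S \<subseteq> M" for M
  proof
    show "M \<subseteq> carrier G"
      using M(1) by (simp add: bracket_closed_def)
    define R where "R = {f. \<phi> f \<in> M}"
    have "symplectic.form_closed g R"
      using M(1) by (simp add: symplectic.form_closed_def R_def bracket_closed_def \<phi>_add form)
    moreover have S_R: "S \<subseteq> R"
      using M(2) by (auto simp: R_def)
    moreover obtain n where n: "g = Suc n"
      using g by (cases g) auto
    moreover have "chain_vec i \<in> R" "plane_vec i 0 1 \<in> R" if "i \<le> n" for i
      using S_R that n by (auto simp: S_def)
    moreover have "closing_vec (Suc n) \<in> R"
      using S_R n by (simp add: S_def)
    ultimately have "lattice_upto g - {0} \<subseteq> R"
      using lattice_upto_subset_form_closed[of g R n] by simp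
    then have "lattice_upto g \<subseteq> R"
      using S_R by (auto simp: S_def)
    then show "carrier G \<subseteq> M"
      using \<phi>_surj by (auto simp: R_def)
  qed
  then have "generates_goldman G \<omega> (basis_elt ` \<phi> ` S)"
    using generates_goldman_basis_iff[OF is_monoid S_carrier] by blast
  then show ?thesis
    using S_carrier card fin by blast
qed

text \<open>Such an element lies in the radical, yet differs from the identity by uniqueness of
  coordinates.\<close>

lemma degenerate_Z_basis_element:
  assumes "Z_basis_group G I e" and \<omega>: "skew_bilinear G \<omega>" and i: "i \<in> I"
    and orth: "\<And>k. k \<in> I \<Longrightarrow> \<omega> (e k) (e i) = 0"
  shows "\<not> nondegenerate G \<omega>"
proof
  assume nondeg: "nondegenerate G \<omega>"
  interpret Z_basis_group G I e by fact
  have "\<omega> (e i) x = 0" if x: "x \<in> carrier G" for x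
  proof -
    obtain f where "x = Z_comb f"
      using Z_comb_surj[OF x] by blast
    then have "\<omega> x (e i) = 0"
      using form_Z_comb_left[OF \<omega>, of "e i" f] i orth by simp
    then show ?thesis
      using skew_bilinear_skew[OF \<omega> _ x, of "e i"] i by simp
  qed
  then have "Z_comb (\<lambda>j. if j = i then 1 else 0) = Z_comb 0"
    using nondeg i Z_comb_delta[OF i] by (simp add: nondegenerate_def)
  from Z_comb_eqD[OF this i] show False
    by simp
qed

text \<open>Disjoint loops are vacuously transverse, and the sum over their crossings is
  empty.\<close>

lemma intersection_form_disjoint:
  assumes "intersection_form X \<A> \<omega>" "simple_loop X p" "simple_loop X q" "range p \<inter> range q = {}"
  shows "\<omega> (loop_class X p) (loop_class X q) = 0"
proof -
  have "crossings p q = {}"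
    using assms(4) by (auto simp: crossings_def)
  then show ?thesis
    using assms by (simp add: intersection_form_def simple_loop_def transverse_def intersection_number_def)
qed

lemma intersection_form_crossing_once:
  assumes "intersection_form X \<A> \<omega>" "simple_loop X p" "simple_loop X q"
    and "crossings p q = {x}" "crosses_with_sign \<A> p q 1 x"
  shows "\<omega> (loop_class X p) (loop_class X q) = 1"
  using assms by (simp add: intersection_form_def simple_loop_def transverse_def intersection_number_def)

theorem theorem1p1:
  fixes X :: "'a topology"
    and \<A> :: "('a set \<times> ('a \<Rightarrow> complex)) set"
    and \<omega> :: "'a chain set \<Rightarrow> 'a chain set \<Rightarrow> int"
    and g :: nat
  assumes "compact_connected_surface X"
    and "surface_orientation X \<A>"
    and "has_genus X \<A> g"
    and "g \<ge> 1"
    and "intersection_form X \<A> \<omega>"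
    and "nondegenerate (homology_group 1 X) \<omega>"
  shows "(\<exists>S. S \<subseteq> carrier (homology_group 1 X) \<and>
            generates_goldman (homology_group 1 X) \<omega> (basis_elt ` S) \<and>
            finite S \<and> card S = 2 * g + 2) \<and>
         (\<exists>T. finite T \<and> generates_goldman (homology_group 1 X) \<omega> T) \<and>
         (\<forall>S. S \<subseteq> carrier (homology_group 1 X) \<and>
            generates_goldman (homology_group 1 X) \<omega> (basis_elt ` S) \<longrightarrow>
            infinite S \<or> card S \<ge> 2 * g + 2)"
proof -
  let ?H = "homology_group 1 X"
  have \<omega>: "skew_bilinear ?H \<omega>"
    using assms(5) by (simp add: intersection_form_def)
  obtain r :: nat and a b c where
    a: "\<And>i. i < g \<Longrightarrow> simple_loop X (a i)" "\<And>i. i < g \<Longrightarrow> range (a i) \<subseteq> surface_interior X"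
    and b: "\<And>i. i < g \<Longrightarrow> simple_loop X (b i)" "\<And>i. i < g \<Longrightarrow> range (b i) \<subseteq> surface_interior X"
    and c: "\<And>j. j < r \<Longrightarrow> simple_loop X (c j)" "\<And>j. j < r \<Longrightarrow> range (c j) \<subseteq> surface_boundary X"
    and ab: "\<And>i. i < g \<Longrightarrow> \<exists>x. crossings (a i) (b i) = {x} \<and> crosses_with_sign \<A> (a i) (b i) 1 x"
    and disj: "\<And>i j. i < g \<Longrightarrow> j < g \<Longrightarrow> i \<noteq> j \<Longrightarrow>
        range (a i) \<inter> range (a j) = {} \<and> range (b i) \<inter> range (b j) = {} \<and>
        range (a i) \<inter> range (b j) = {}"
    and cc: "\<And>i j. i < r \<Longrightarrow> j < r \<Longrightarrow> i \<noteq> j \<Longrightarrow> range (c i) \<inter> range (c j) = {}"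
    and basis: "Z_basis ?H ({..<g} <+> {..<g} <+> {..<r})
       (case_sum (loop_class X \<circ> a) (case_sum (loop_class X \<circ> b) (loop_class X \<circ> c)))"
    using assms(3) unfolding has_genus_def by (elim exE conjE) (rule that, auto)
  define e where "e = case_sum (loop_class X \<circ> a) (case_sum (loop_class X \<circ> b) (loop_class X \<circ> c))"
  let ?I = "{..<g} <+> {..<g} <+> {..<r}"
  interpret H: Z_basis_group ?H ?I e
    using basis abelian_homology_group
    by (simp add: e_def Z_basis_group_def Z_basis_group_axioms_def)
  note disjoint = intersection_form_disjoint[OF assms(5)]
  \<comment> \<open>A loop meets itself infinitely often and so is not transverse to itself; skew
    symmetry gives the value instead.\<close>
  have self: "\<omega> (e i) (e i) = 0" if "i \<in> ?I" for i
    using skew_bilinear_skew[OF \<omega>, of "e i" "e i"] H.basis_closed[OF that] by simp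
  \<comment> \<open>Otherwise the boundary curve \<open>c 0\<close> is disjoint from all other basis
    curves, so its class lies in the radical.\<close>
  have "r = 0"
  proof (rule ccontr)
    assume "r \<noteq> 0"
    have interior_boundary: "U \<inter> V = {}" if "U \<subseteq> surface_interior X" "V \<subseteq> surface_boundary X" for U V
      using that by (auto simp: surface_boundary_def)
    have "\<omega> (e k) (e (Inr (Inr 0))) = 0" if "k \<in> ?I" for k
      using that
    proof (elim PlusE)
      fix i
      assume "i \<in> {..<g}" "k = Inl i"
      then show ?thesis
        using disjoint[OF a(1) c(1) interior_boundary[OF a(2) c(2)], of i 0] \<open>r \<noteq> 0\<close> by (simp add: e_def)
    next
      fix k' i
      assume "k = Inr k'" "i \<in> {..<g}" "k' = Inl i"
      then show ?thesis
        using disjoint[OF b(1) c(1) interior_boundary[OF b(2) c(2)], of i 0] \<open>r \<noteq> 0\<close> by (simp add: e_def)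
    next
      fix k' j
      assume j: "k = Inr k'" "j \<in> {..<r}" "k' = Inr j"
      show ?thesis
      proof (cases "j = 0")
        case True
        then show ?thesis
          using self[OF that] j by simp
      next
        case False
        then show ?thesis
          using disjoint[OF c(1) c(1) cc, of j 0] j \<open>r \<noteq> 0\<close> by (simp add: e_def)
      qed
    qed
    moreover have "Inr (Inr 0) \<in> ?I"
      using \<open>r \<noteq> 0\<close> by auto
    ultimately show False
      using degenerate_Z_basis_element[OF H.Z_basis_group_axioms \<omega>] assms(6) by blast
  qed
  then have Z: "Z_basis_group ?H ({..<g} <+> {..<g} <+> {}) e"
    using H.Z_basis_group_axioms by simp
  have AA: "\<omega> (e (Inl i)) (e (Inl j)) = 0" if "i < g" "j < g" for i j
    using disjoint[OF a(1) a(1), of i j] disj[OF that] self[of "Inl i"] that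
    by (cases "i = j") (auto simp: e_def)
  have BB: "\<omega> (e (Inr (Inl i))) (e (Inr (Inl j))) = 0" if "i < g" "j < g" for i j
    using disjoint[OF b(1) b(1), of i j] disj[OF that] self[of "Inr (Inl i)"] that
    by (cases "i = j") (auto simp: e_def)
  have AB: "\<omega> (e (Inl i)) (e (Inr (Inl j))) = (if i = j then 1 else 0)" if "i < g" "j < g" for i j
    using disjoint[OF a(1) b(1), of i j] disj[OF that] that ab[of i]
      intersection_form_crossing_once[OF assms(5) a(1) b(1), of i i]
    by (cases "i = j") (auto simp: e_def)
  have lower: "card S \<ge> 2 * g + 2"
    if "finite S" "S \<subseteq> carrier ?H" "generates_goldman ?H \<omega> (basis_elt ` S)" for S
  proof -
    have "card ({..<g} <+> {..<g} <+> ({} :: nat set)) = 2 * g"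
      by (simp add: card_Plus)
    moreover have "{..<g} <+> {..<g} <+> ({} :: nat set) \<noteq> {}"
      using \<open>g \<ge> 1\<close> by (auto simp: lessThan_empty_iff)
    ultimately show ?thesis
      using card_goldman_generators[OF Z _ \<omega> that] by simp
  qed
  obtain S where S: "S \<subseteq> carrier ?H" "finite S" "card S \<le> 2 * g + 2"
      "generates_goldman ?H \<omega> (basis_elt ` S)"
    using symplectic_goldman_generators[OF Z \<omega> \<open>g \<ge> 1\<close> AA BB AB] by blast
  then have "card S = 2 * g + 2"
    using lower[OF S(2,1,4)] by linarith
  moreover have "finite (basis_elt ` S)"
    using S(2) by simp
  ultimately show ?thesis
    using S lower by blast
qed

end
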